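(* The dilogarithm $\mathrm{Li}_2$ satisfies, for $j=0,2,4$ (all indices taken modulo $6$), $$\mathrm{Li}_2(z_j)+\log z_j\,\log z_{j+1}+\mathrm{Li}_2(z_{j+1})=\zeta(2)\qquad (z\in\mathbf{D}_{t_j^{-1}(0)}\cap\mathbf{D}_{t_j^{-1}(1)}),$$ $$\mathrm{Li}_2(z_{j-1})=-\mathrm{Li}_2(z_j)-\tfrac12\log^2 z_{j+1}\qquad (z\in\mathbf{D}_{t_j^{-1}(0)}).$$
   Context: Let $\mathbf{P}^1=\mathbf{C}\cup\{\infty\}$ be the Riemann sphere, with open subsets $\mathbf{D}_0=\mathbf{C}\setminus[1,+\infty)$, $\mathbf{D}_1=\mathbf{C}\setminus(-\infty,0]$, $\mathbf{D}_\infty=\mathbf{P}^1\setminus[0,1]$. Define automorphisms $t_i$ of $\mathbf{P}^1$ and write $z_i=t_i(z)$: $z_0=z$, $z_1=1-z$, $z_2=\frac{z-1}{z}$, $z_3=\frac1z$, $z_4=\frac1{1-z}$, $z_5=\frac{z}{z-1}$; the index $i$ is taken modulo $6$. One has $t_0^{-1}(0)=0,\ t_0^{-1}(1)=1$; $t_2^{-1}(0)=1,\ t_2^{-1}(1)=\infty$; $t_4^{-1}(0)=\infty,\ t_4^{-1}(1)=0$. Each $t_i$ gives an analytic isomorphism $\mathbf{D}_\alpha\to\mathbf{D}_{t_i(\alpha)}$ for $\alpha\in\{0,1,\infty\}$. $\log$ denotes the principal branch on $\mathbf{C}\setminus(-\infty,0]$ (with $\log 1=0$), and $\log^2 w=(\log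 w)^2$. $\zeta(2)=\sum_{n\ge1}n^{-2}$. The dilogarithm $\mathrm{Li}_2$ is the holomorphic function on $\mathbf{D}_0$ given by $\mathrm{Li}_2(z)=-\int_0^z\frac{\log(1-t)}{t}\,dt$ (integral along a path in $\mathbf{D}_0$), so that $\mathrm{Li}_2(z)=\sum_{n\ge1}z^n/n^2$ for $|z|<1$. *)

theory Defs
  imports "HOL-Complex_Analysis.Complex_Analysis"
begin

text \<open>
  The Riemann sphere is the one-point compactification of the complex plane; as in
  \<open>Alexandroff_compactification\<close>, its points are represented in an option type,
  \<open>None\<close> being the point at infinity.
\<close>

type_synonym riemann_sphere = "complex option"

text \<open>
  The transformation \<open>z \<mapsto> (a z + b) / (c z + d)\<close> of the sphere, for \<open>a d - b c \<noteq> 0\<close>.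
\<close>

definition sphere_moebius ::
    "complex \<Rightarrow> complex \<Rightarrow> complex \<Rightarrow> complex \<Rightarrow> riemann_sphere \<Rightarrow> riemann_sphere" where
  "sphere_moebius a b c d p =
     (case p of
        None \<Rightarrow> if c = 0 then None else Some (a / c)
      | Some z \<Rightarrow> if c * z + d = 0 then None else Some ((a * z + b) / (c * z + d)))"

definition tr :: "int \<Rightarrow> riemann_sphere \<Rightarrow> riemann_sphere" where
  "tr i =
     (let k = i mod 6 in
      if k = 0 then (\<lambda>p. p)
      else if k = 1 then sphere_moebius (-1) 1 0 1     \<comment> \<open>\<open>1 - z\<close>\<close>
      else if k = 2 then sphere_moebius 1 (-1) 1 0     \<comment> \<open>\<open>(z - 1) / z\<close>\<close>
      else if k = 3 then sphere_moebius 0 1 1 0        \<comment> \<open>\<open>1 / z\<close>\<close>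
      else if k = 4 then sphere_moebius 0 1 (-1) 1     \<comment> \<open>\<open>1 / (1 - z)\<close>\<close>
      else sphere_moebius 1 0 1 (-1))                  \<comment> \<open>\<open>z / (z - 1)\<close>\<close>"

text \<open>
  The three domains, indexed by the points \<open>0\<close>, \<open>1\<close>, \<open>\<infinity>\<close> of the sphere; the index is
  irrelevant at all other points.
\<close>

definition Dom :: "riemann_sphere \<Rightarrow> riemann_sphere set" where
  "Dom \<alpha> =
     (if \<alpha> = Some 0 then Some ` (UNIV - of_real ` {1..})
      else if \<alpha> = Some 1 then Some ` (UNIV - of_real ` {..0})
      else if \<alpha> = None then UNIV - Some ` of_real ` {0..1}
      else {})"

text \<open>
  The integrand \<open>- log (1 - t) / t\<close> has a removable singularity at \<open>0\<close>, with value \<open>1\<close>.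
  The path of integration is the segment; lemma \<open>Li2_path\<close> gives the same value along every path
  from \<open>0\<close> to \<open>z\<close> in the slit plane.
\<close>

definition Li2_integrand :: "complex \<Rightarrow> complex" where
  "Li2_integrand t = (if t = 0 then 1 else - (Ln (1 - t) / t))"

definition Li2 :: "complex \<Rightarrow> complex" where
  "Li2 z = contour_integral (linepath 0 z) Li2_integrand"

definition zeta2 :: complex where
  "zeta2 = (\<Sum>n. 1 / of_nat (Suc n) ^ 2)"

lemma tr_1_comp_3: "tr 2 p = tr 1 (tr 3 p)"
  by (auto simp: tr_def sphere_moebius_def divide_simps algebra_simps split: option.splits)

lemma tr_3_comp_1: "tr 4 p = tr 3 (tr 1 p)"
  by (auto simp: tr_def sphere_moebius_def divide_simps split: option.splits)

lemma tr_1_comp_4: "tr 5 p = tr 1 (tr 4 p)"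
  by (auto simp: tr_def sphere_moebius_def divide_simps split: option.splits) (simp add: algebra_simps)

lemma tr_involutive: "tr 1 (tr 1 p) = p" "tr 3 (tr 3 p) = p"
  by (auto simp: tr_def sphere_moebius_def split: option.splits)

lemma tr_inverse_values:
  "inv (tr 0) (Some 0) = Some 0" "inv (tr 0) (Some 1) = Some 1"
  "inv (tr 2) (Some 0) = Some 1" "inv (tr 2) (Some 1) = None"
  "inv (tr 4) (Some 0) = None" "inv (tr 4) (Some 1) = Some 0"
proof -
  have "inj (tr 0)"
    by (simp add: tr_def)
  moreover have "inj (tr 1)" "inj (tr 3)"
    by (metis tr_involutive injI)+
  then have "inj (tr 2)" "inj (tr 4)"
    unfolding inj_def tr_1_comp_3 tr_3_comp_1 by blast+
  ultimately show
    "inv (tr 0) (Some 0) = Some 0" "inv (tr 0) (Some 1) = Some 1"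
    "inv (tr 2) (Some 0) = Some 1" "inv (tr 2) (Some 1) = None"
    "inv (tr 4) (Some 0) = None" "inv (tr 4) (Some 1) = Some 0"
    by (intro inv_f_eq; simp add: tr_def sphere_moebius_def)+
qed

lemma in_Dom_iff:
  "Some z \<in> Dom (Some 0) \<longleftrightarrow> z \<notin> complex_of_real ` {1..}"
  "Some z \<in> Dom (Some 1) \<longleftrightarrow> z \<notin> complex_of_real ` {..0}"
  "Some z \<in> Dom None \<longleftrightarrow> z \<notin> complex_of_real ` {0..1}"
  "None \<in> Dom \<alpha> \<longleftrightarrow> \<alpha> = None"
  unfolding Dom_def by (auto simp del: image_image)

lemma tr_1_Dom:
  assumes "\<alpha> \<in> {Some 0, Some 1, None}" "p \<in> Dom \<alpha>"
  shows "tr 1 p \<in> Dom (tr 1 \<alpha>)"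
proof -
  have *: "1 - z \<notin> complex_of_real ` A"
    if "z \<notin> complex_of_real ` B" "\<And>x. x \<in> A \<Longrightarrow> 1 - x \<in> B" for A B z
  proof
    assume "1 - z \<in> complex_of_real ` A"
    then obtain x where x: "1 - z = complex_of_real x" "x \<in> A" by auto
    then have "z = complex_of_real (1 - x)" by (simp add: algebra_simps)
    with that(1) that(2)[OF x(2)] show False by blast
  qed
  have "1 - z \<notin> complex_of_real ` {0..1}" if "z \<notin> complex_of_real ` {0..1}" for z
    by (rule *[OF that]) auto
  moreover have "1 - z \<notin> complex_of_real ` {1..}" if "z \<notin> complex_of_real ` {..0}" for z
    by (rule *[OF that]) auto
  moreover have "1 - z \<notin> complex_of_real ` {..0}" if "z \<notin> complex_of_real ` {1..}" for z
    by (rule *[OF that]) auto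
  ultimately show ?thesis
    using assms by (cases p) (auto simp: tr_def sphere_moebius_def in_Dom_iff)
qed

lemma tr_3_Dom:
  assumes "\<alpha> \<in> {Some 0, Some 1, None}" "p \<in> Dom \<alpha>"
  shows "tr 3 p \<in> Dom (tr 3 \<alpha>)"
proof -
  have eq: "z = complex_of_real (1 / x)" if "1 / z = complex_of_real x" "z \<noteq> 0" for z x
    using that by (cases "x = 0") (auto simp: field_simps)
  show ?thesis
  proof (cases p)
    case None
    with assms show ?thesis
      by (auto simp: tr_def sphere_moebius_def in_Dom_iff)
  next
    case (Some z)
    show ?thesis
    proof (cases "z = 0")
      case True
      with Some assms show ?thesis
        by (auto simp: tr_def sphere_moebius_def in_Dom_iff)
    next
      case False
      have *: "1 / z \<notin> complex_of_real ` A"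
        if "z \<notin> complex_of_real ` B" "\<And>x. x \<in> A \<Longrightarrow> x \<noteq> 0 \<Longrightarrow> 1 / x \<in> B" for A B
      proof
        assume "1 / z \<in> complex_of_real ` A"
        then obtain x where x: "1 / z = complex_of_real x" "x \<in> A" by auto
        then have "x \<noteq> 0" using False by auto
        with that(2) x(2) have "1 / x \<in> B" by simp
        then have "z \<in> complex_of_real ` B"
          unfolding eq[OF x(1) False] by (rule imageI)
        with that(1) show False by contradiction
      qed
      have "1 / z \<notin> complex_of_real ` {0..1}" if "z \<notin> complex_of_real ` {1..}"
        by (rule *[OF that]) (auto simp: divide_simps)
      moreover have "1 / z \<notin> complex_of_real ` {1..}" if "z \<notin> complex_of_real ` {0..1}"
        by (rule *[OF that]) (auto simp: divide_simps)
      moreover have "1 / z \<notin> complex_of_real ` {..0}" if "z \<notin> complex_of_real ` {..0}"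
        by (rule *[OF that]) (auto simp: divide_simps)
      ultimately show ?thesis
        using Some False assms
        by (elim insertE) (simp_all add: tr_def sphere_moebius_def in_Dom_iff)
    qed
  qed
qed

text \<open>
  In particular, \<open>tr j p\<close> is a finite point whenever \<open>Li2\<close> or the logarithm is to be taken of it,
  because it then lies in \<open>Dom (Some 0)\<close> or \<open>Dom (Some 1)\<close>.
\<close>

lemma tr_Dom:
  assumes "\<alpha> \<in> {Some 0, Some 1, None}" "p \<in> Dom \<alpha>"
  shows "tr i p \<in> Dom (tr i \<alpha>)"
proof -
  have inv1: "tr 1 \<beta> \<in> {Some 0, Some 1, None}" and inv3: "tr 3 \<beta> \<in> {Some 0, Some 1, None}"
    if "\<beta> \<in> {Some 0, Some 1, None}" for \<beta>
    using that by (auto simp: tr_def sphere_moebius_def)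
  have mod6: "tr i = tr k" if "i mod 6 = k mod 6" for k
    using that by (simp add: tr_def)
  have "i mod 6 = 0 \<or> i mod 6 = 1 \<or> i mod 6 = 2 \<or> i mod 6 = 3 \<or> i mod 6 = 4 \<or> i mod 6 = 5"
    by presburger
  moreover have "tr 0 p \<in> Dom (tr 0 \<alpha>)"
    using assms by (simp add: tr_def)
  moreover have 1: "tr 1 p \<in> Dom (tr 1 \<alpha>)" and 3: "tr 3 p \<in> Dom (tr 3 \<alpha>)"
    using tr_1_Dom[OF assms] tr_3_Dom[OF assms] by auto
  moreover have "tr 2 p \<in> Dom (tr 2 \<alpha>)"
    using tr_1_Dom[OF inv3[OF assms(1)] 3] by (simp only: tr_1_comp_3)
  moreover have 4: "tr 4 p \<in> Dom (tr 4 \<alpha>)"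
    using tr_3_Dom[OF inv1[OF assms(1)] 1] by (simp only: tr_3_comp_1)
  moreover have "tr 5 p \<in> Dom (tr 5 \<alpha>)"
    using tr_1_Dom[OF inv3[OF inv1[OF assms(1)]]] 4 by (simp only: tr_1_comp_4 tr_3_comp_1)
  ultimately show ?thesis
    using mod6[of 0] mod6[of 1] mod6[of 2] mod6[of 3] mod6[of 4] mod6[of 5] by (elim disjE) simp_all
qed

lemma slit_plane_segment:
  assumes "z \<notin> complex_of_real ` {1..}"
  shows "closed_segment 0 z \<subseteq> UNIV - complex_of_real ` {1..}"
proof
  fix w assume "w \<in> closed_segment 0 z"
  then obtain u where u: "0 \<le> u" "u \<le> 1" "w = of_real u * z"
    by (auto simp: in_segment scaleR_conv_of_real)
  have "z \<in> complex_of_real ` {1..}" if "w = of_real x" "x \<ge> 1" for x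
  proof -
    have "u > 0" using u that by (cases "u = 0") auto
    then show ?thesis
      using u that by (intro image_eqI[of _ _ "x / u"]) (auto simp: field_simps)
  qed
  with assms show "w \<in> UNIV - complex_of_real ` {1..}" by auto
qed

lemma slit_plane: "open (UNIV - complex_of_real ` {1..})" "starlike (UNIV - complex_of_real ` {1..})"
proof -
  have eq: "complex_of_real ` {1..} = (\<lambda>z. 1 - z) ` \<real>\<^sub>\<le>\<^sub>0"
  proof (intro equalityI subsetI)
    fix z assume "z \<in> complex_of_real ` {1..}"
    then have "1 - z \<in> \<real>\<^sub>\<le>\<^sub>0" by (auto simp: complex_nonpos_Reals_iff)
    then show "z \<in> (\<lambda>z. 1 - z) ` \<real>\<^sub>\<le>\<^sub>0" by (intro image_eqI[of _ _ "1 - z"]) auto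
  next
    fix z :: complex assume "z \<in> (\<lambda>z. 1 - z) ` \<real>\<^sub>\<le>\<^sub>0"
    then show "z \<in> complex_of_real ` {1..}"
      by (auto simp: complex_nonpos_Reals_iff complex_eq_iff intro!: image_eqI[of _ _ "1 - Re _"])
  qed
  have "closed ((\<lambda>z::complex. 1 - z) ` \<real>\<^sub>\<le>\<^sub>0)"
    using closed_translation[OF closed_negations[OF closed_nonpos_Reals_complex], of 1]
    by (simp add: image_image)
  then show "open (UNIV - complex_of_real ` {1..})"
    unfolding eq by (simp add: open_Diff)
  have "closed_segment 0 z \<subseteq> UNIV - complex_of_real ` {1..}" if "z \<notin> complex_of_real ` {1..}" for z :: complex
    using slit_plane_segment that by simp
  moreover have "0 \<in> UNIV - complex_of_real ` {1..}"
    by auto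
  ultimately show "starlike (UNIV - complex_of_real ` {1..})"
    unfolding starlike_def by blast
qed

lemma Li2_integrand_holomorphic:
  "Li2_integrand holomorphic_on (UNIV - complex_of_real ` {1..})"
proof -
  let ?S = "UNIV - complex_of_real ` {1..}"
  have cut: "1 - t \<notin> \<real>\<^sub>\<le>\<^sub>0" if "t \<in> ?S" for t
    using that by (auto simp: complex_nonpos_Reals_iff complex_eq_iff image_iff)
  have hol: "(\<lambda>t. - Ln (1 - t)) holomorphic_on ?S"
    by (intro holomorphic_intros) (use cut in auto)
  have "((\<lambda>t. - Ln (1 - t)) has_field_derivative 1) (at 0)"
    by (auto intro!: derivative_eq_intros)
  then have d: "deriv (\<lambda>t. - Ln (1 - t)) 0 = 1"
    by (rule DERIV_imp_deriv)
  have "(\<lambda>t. if t = 0 then deriv (\<lambda>t. - Ln (1 - t)) 0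
             else (- Ln (1 - t) - (- Ln (1 - 0))) / (t - 0)) holomorphic_on ?S"
    by (rule pole_lemma_open[OF hol slit_plane(1)])
  then show ?thesis
    unfolding d Li2_integrand_def by (simp add: Li2_integrand_def cong: if_cong)
qed

lemma Li2_path_and_derivative:
  shows Li2_path:
    "\<lbrakk>valid_path g; path_image g \<subseteq> UNIV - complex_of_real ` {1..}; pathstart g = 0; pathfinish g = z\<rbrakk>
       \<Longrightarrow> (Li2_integrand has_contour_integral Li2 z) g"
    and Li2_has_field_derivative:
      "z \<in> UNIV - complex_of_real ` {1..} \<Longrightarrow> (Li2 has_field_derivative Li2_integrand z) (at z)"
proof -
  let ?S = "UNIV - complex_of_real ` {1..}"
  have "Li2_integrand field_differentiable at x" if "x \<in> ?S" for x
    using Li2_integrand_holomorphic slit_plane(1) that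
    by (auto simp: holomorphic_on_open field_differentiable_def)
  then have "\<exists>F. \<forall>x \<in> ?S. (F has_field_derivative Li2_integrand x) (at x)"
    by (intro holomorphic_starlike_primitive[OF _ slit_plane(2,1) finite.emptyI]
          holomorphic_on_imp_continuous_on Li2_integrand_holomorphic) auto
  then obtain F where F: "\<And>x. x \<in> ?S \<Longrightarrow> (F has_field_derivative Li2_integrand x) (at x)"
    by blast
  have path: "(Li2_integrand has_contour_integral (F (pathfinish g) - F (pathstart g))) g"
    if "valid_path g" "path_image g \<subseteq> ?S" for g
    by (rule contour_integral_primitive[OF _ that]) (auto intro: F has_field_derivative_at_within)
  have Li2: "Li2 w = F w - F 0" if "w \<in> ?S" for w
    unfolding Li2_def
    using contour_integral_unique[OF path[of "linepath 0 w"]] slit_plane_segment[of w] that by simp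
  show "(Li2_integrand has_contour_integral Li2 z) g"
    if g: "valid_path g" "path_image g \<subseteq> ?S" "pathstart g = 0" "pathfinish g = z"
  proof -
    have "z \<in> ?S"
      using g pathfinish_in_path_image[of g] by auto
    then show ?thesis
      using path[OF g(1,2)] g(3,4) Li2 by simp
  qed
  show "(Li2 has_field_derivative Li2_integrand z) (at z)" if "z \<in> ?S"
  proof (rule has_field_derivative_transform_within_open[OF _ slit_plane(1) that])
    show "((\<lambda>w. F w - F 0) has_field_derivative Li2_integrand z) (at z)"
      using F[OF that] by (auto intro!: derivative_eq_intros)
  qed (simp add: Li2)
qed

end

theory Submission
  imports Defs "HOL-Real_Asymp.Real_Asymp"
begin

text \<open>
  With \<open>w = z\<^bsub>j\<^esub>\<close> one has \<open>z\<^bsub>j+1\<^esub> = 1 - w\<close> and \<open>z\<^bsub>j-1\<^esub> = w / (w - 1)\<close>, so all cases reduce to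
  a reflection identity and a Landen identity in \<open>w\<close>.  In each, the difference of the two sides has
  derivative zero on a starlike domain.  The constant of the Landen identity is read off at \<open>w = 0\<close>;
  that of the reflection identity is the limit along the reals as \<open>w\<close> decreases to \<open>0\<close>, where the
  logarithmic term vanishes and \<open>Li\<^sub>2(1 - w)\<close> tends to \<open>\<zeta>(2)\<close> because the power series converges
  uniformly on the closed disc.
\<close>

section \<open>The dilogarithm series on the unit disc and its limit at 1\<close>

lemma summable_inverse_squares_complex: "summable (\<lambda>n. 1 / (of_nat n)\<^sup>2 :: complex)"
proof (rule summable_norm_cancel)
  show "summable (\<lambda>n. norm (1 / (of_nat n)\<^sup>2 :: complex))"
    using inverse_power_summable[of 2, where ?'a = real]
    by (simp add: norm_divide norm_power field_simps)
qed

lemma Ln_one_minus_sums: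
  assumes "norm z < 1"
  shows "(\<lambda>n. z ^ n / of_nat n) sums - Ln (1 - z)"
proof -
  have "(\<lambda>n. - ((-1) ^ Suc n / of_nat n * (- z) ^ n)) sums - Ln (1 + - z)"
    using assms by (intro sums_minus Ln_series) simp
  moreover have "- ((-1) ^ Suc n / of_nat n * (- z) ^ n) = z ^ n / of_nat n" for n
    using power_mult_distrib[of "-1" "- z" n] by simp
  ultimately show ?thesis
    by (simp only: diff_conv_add_uminus)
qed

lemma norm_less_one_imp_slit:
  assumes "norm z < 1"
  shows "z \<notin> complex_of_real ` {1..}"
  using assms by auto

lemma Li2_0: "Li2 0 = 0"
  unfolding Li2_def by simp

text \<open>Termwise differentiation turns the coefficients 1/n^2 into 1/(n+1), the Taylor
  coefficients of \<open>Li2_integrand\<close>, so the two sides differ by a constant, which is 0 at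
  the origin. The summation starts at n = 0, where the coefficient is 1/0 = 0.\<close>

lemma Li2_power_series:
  assumes "norm z < 1"
  shows "Li2 z = (\<Sum>n. 1 / (of_nat n)\<^sup>2 * z ^ n)"
proof -
  let ?c = "\<lambda>n. 1 / (of_nat n)\<^sup>2 :: complex"
  let ?F = "\<lambda>z. \<Sum>n. ?c n * z ^ n"
  have "((\<lambda>z. Li2 z - ?F z) has_field_derivative 0) (at z)" if "norm z < 1" for z
  proof -
    have "(\<Sum>n. diffs ?c n * z ^ n) = Li2_integrand z"
    proof (cases "z = 0")
      case True
      then show ?thesis
        using powser_sums_zero[of "diffs ?c"] by (simp add: diffs_def Li2_integrand_def sums_iff)
    next
      case False
      \<comment> \<open>The logarithm series may be started at index 1, since its term at index 0 is
        \<open>z ^ 0 / of_nat 0\<close>, that is, 0.\<close>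
      have "(\<lambda>n. z ^ Suc n / of_nat (Suc n)) sums - Ln (1 - z)"
        using Ln_one_minus_sums[OF that] by (subst sums_Suc_iff) simp
      then have "(\<lambda>n. z ^ Suc n / of_nat (Suc n) / z) sums (- Ln (1 - z) / z)"
        by (rule sums_divide)
      moreover have "z ^ Suc n / of_nat (Suc n) / z = diffs ?c n * z ^ n" for n
        using False of_nat_neq_0[of n, where ?'a = complex] unfolding diffs_def
        by (simp add: power2_eq_square del: of_nat_Suc)
      ultimately show ?thesis
        using False by (simp add: sums_iff Li2_integrand_def)
    qed
    moreover have "(?F has_field_derivative (\<Sum>n. diffs ?c n * z ^ n)) (at z)"
      by (rule termdiffs_strong[of _ 1])
        (use that summable_inverse_squares_complex in auto)
    ultimately show ?thesis
      using DERIV_diff[OF Li2_has_field_derivative] norm_less_one_imp_slit[OF that] by fastforce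
  qed
  then have "\<exists>k. \<forall>z \<in> ball 0 1. Li2 z - ?F z = k"
    by (intro has_field_derivative_zero_constant)
      (auto intro: has_field_derivative_at_within)
  then obtain k where k: "\<And>z. norm z < 1 \<Longrightarrow> Li2 z - ?F z = k"
    by auto
  have "k = 0"
    using k[of 0] powser_zero[of ?c] by (simp add: Li2_0)
  then show ?thesis
    using k[OF assms] by simp
qed

text \<open>The summation here starts one index earlier than in \<open>zeta2_def\<close>; the extra
  term is 1/0 = 0.\<close>

lemma zeta2_eq: "zeta2 = (\<Sum>n. 1 / (of_nat n)\<^sup>2)"
  unfolding zeta2_def
  using suminf_split_head[OF summable_inverse_squares_complex] by simp

text \<open>The point 1 lies on the cut, so differentiability of \<open>Li2\<close> on the slit
  plane does not give the limit. The series is continuous on the closed disc, with majorant 1/n^2,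
  and agrees with \<open>Li2\<close> on the open disc; this is why the limit is taken within the
  open disc.\<close>

lemma Li2_tendsto_zeta2: "(Li2 \<longlongrightarrow> zeta2) (at 1 within ball 0 1)"
proof -
  let ?F = "\<lambda>z. \<Sum>n. 1 / (of_nat n)\<^sup>2 * z ^ n :: complex"
  have lim: "uniform_limit (cball 0 1) (\<lambda>n z. \<Sum>i<n. 1 / (of_nat i)\<^sup>2 * z ^ i :: complex) ?F sequentially"
  proof (rule Weierstrass_m_test)
    show "summable (\<lambda>n. 1 / (real n)\<^sup>2)"
      using inverse_power_summable[of 2, where ?'a = real] by (simp add: field_simps)
    show "norm (1 / (of_nat n)\<^sup>2 * z ^ n :: complex) \<le> 1 / (real n)\<^sup>2" if "z \<in> cball 0 1" for n z
      using that by (simp add: norm_mult norm_divide norm_power divide_right_mono power_le_one)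
  qed
  have "\<forall>\<^sub>F n in sequentially.
      continuous_on (cball 0 1) (\<lambda>z. \<Sum>i<n. 1 / (of_nat i)\<^sup>2 * z ^ i :: complex)"
    by (rule always_eventually) (intro allI continuous_intros)
  then have "continuous_on (cball 0 1) ?F"
    by (rule uniform_limit_theorem[OF _ lim trivial_limit_sequentially])
  then have "(?F \<longlongrightarrow> ?F 1) (at 1 within cball 0 1)"
    unfolding continuous_on_def by (rule bspec) simp
  then have "(?F \<longlongrightarrow> ?F 1) (at 1 within ball 0 1)"
    by (rule tendsto_within_subset) auto
  moreover have "\<forall>\<^sub>F z in at 1 within ball 0 1. ?F z = Li2 z"
    by (auto simp: eventually_at_filter Li2_power_series intro!: always_eventually)
  ultimately have "(Li2 \<longlongrightarrow> ?F 1) (at 1 within ball 0 1)"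
    by (simp add: tendsto_cong)
  then show ?thesis
    by (simp add: zeta2_eq)
qed

section \<open>The Landen identity on the slit plane\<close>

lemma notin_slit_iff: "z \<notin> complex_of_real ` {1..} \<longleftrightarrow> 1 - z \<notin> \<real>\<^sub>\<le>\<^sub>0"
  by (auto simp: complex_nonpos_Reals_iff complex_eq_iff image_iff)

lemma nonpos_Reals_eq: "complex_of_real ` {..0} = \<real>\<^sub>\<le>\<^sub>0"
  by (auto simp: nonpos_Reals_def)

text \<open>Since 1 - w/(w-1) = 1/(1-w), the map w/(w-1) preserves the slit plane and changes the
  sign of \<open>Ln (1 - w)\<close>. By the chain rule \<open>Li2 (w / (w - 1))\<close> has
  derivative Ln(1-w)/(w(1-w)) for nonzero w, and its partial fractions Ln(1-w)/w + Ln(1-w)/(1-w)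
  cancel the derivatives of the other two terms.\<close>

lemma Li2_landen:
  assumes "w \<notin> complex_of_real ` {1..}"
  shows "Li2 (w / (w - 1)) = - Li2 w - 1/2 * (Ln (1 - w))\<^sup>2"
proof -
  let ?S = "UNIV - complex_of_real ` {1..}"
  let ?G = "\<lambda>w. Li2 (w / (w - 1)) + Li2 w + 1/2 * (Ln (1 - w))\<^sup>2"
  have "(?G has_field_derivative 0) (at w)" if "w \<in> ?S" for w
  proof -
    have cut: "1 - w \<notin> \<real>\<^sub>\<le>\<^sub>0" using that by (simp add: notin_slit_iff)
    then have w1: "w \<noteq> 1" by auto
    have inv: "1 - w / (w - 1) = inverse (1 - w)"
      using w1 by (simp add: field_simps)
    have slit: "w / (w - 1) \<in> ?S"
      using cut by (simp add: notin_slit_iff inv)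
    have Ln: "Ln (1 - w / (w - 1)) = - Ln (1 - w)"
      unfolding inv by (rule Ln_inverse[OF cut])
    have 1: "((\<lambda>w. w / (w - 1)) has_field_derivative - 1 / (w - 1)\<^sup>2) (at w)"
      using w1 by (auto intro!: derivative_eq_intros simp: power2_eq_square field_simps)
    have 2: "((\<lambda>w. 1/2 * (Ln (1 - w))\<^sup>2) has_field_derivative - Ln (1 - w) / (1 - w)) (at w)"
      using cut w1 by (auto intro!: derivative_eq_intros simp: field_simps)
    have "(?G has_field_derivative
        Li2_integrand (w / (w - 1)) * (- 1 / (w - 1)\<^sup>2) + Li2_integrand w + - Ln (1 - w) / (1 - w)) (at w)"
      by (intro DERIV_add 2 DERIV_chain2[OF Li2_has_field_derivative[OF slit] 1]
          Li2_has_field_derivative that)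
    moreover have "Li2_integrand (w / (w - 1)) * (- 1 / (w - 1)\<^sup>2) + Li2_integrand w
        + - Ln (1 - w) / (1 - w) = 0"
    \<comment> \<open>At w = 0 both integrands take the removable value 1, and the sum is -1 + 1 +
      0. Elsewhere, writing w = d + 1 leaves only d + 1 and powers of d, up to sign, as denominators
      to be cleared.\<close>
    proof (cases "w = 0")
      case False
      define d where "d = w - 1"
      have d: "d \<noteq> 0" "w = d + 1" "1 - w = - d" "d + 1 \<noteq> 0" using w1 False by (auto simp: d_def)
      have eq: "Li2_integrand (w / (w - 1)) = Ln (1 - w) / (w / (w - 1))"
        using False w1 by (simp add: Li2_integrand_def Ln)
      then show ?thesis
        using False d(1,4) unfolding eq unfolding Li2_integrand_def d_def[symmetric] d(2,3)
        by (simp add: divide_simps power2_eq_square) (simp add: algebra_simps)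
    qed (simp add: Li2_integrand_def)
    ultimately show ?thesis by simp
  qed
  then have "?G constant_on ?S"
    using slit_plane by (intro has_field_derivative_0_imp_constant_on starlike_imp_connected)
  moreover have "0 \<in> ?S"
    using norm_less_one_imp_slit[of 0] by simp
  ultimately have "?G w = ?G 0"
    using assms unfolding constant_on_def by (metis (lifting) DiffI UNIV_I)
  then have "?G w = 0"
    by (simp add: Li2_0)
  then show ?thesis
    by algebra
qed

section \<open>The reflection identity on the plane with both slits removed\<close>

lemma doubly_slit_plane:
  fixes S :: "complex set"
  defines "S \<equiv> {w. w \<notin> complex_of_real ` {1..} \<and> w \<notin> complex_of_real ` {..0}}"
  shows "open S" and "connected S"
proof -
  have "S = (UNIV - complex_of_real ` {1..}) \<inter> - \<real>\<^sub>\<le>\<^sub>0"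
    by (auto simp: S_def nonpos_Reals_eq)
  then show "open S"
    using slit_plane(1) by (simp add: open_Int open_Compl)
  have S: "w \<in> S \<longleftrightarrow> Im w \<noteq> 0 \<or> 0 < Re w \<and> Re w < 1" for w
    by (auto simp: S_def notin_slit_iff nonpos_Reals_eq complex_nonpos_Reals_iff)
  \<comment> \<open>The set consists of the non-real numbers and the interval (0,1), and 1/2 serves
    as star centre: a segment towards a non-real w leaves the real axis immediately, and one towards
    a real w stays in (0,1).\<close>
  have "closed_segment (1/2) w \<subseteq> S" if w: "w \<in> S" for w
  proof
    fix v assume "v \<in> closed_segment (1/2) w"
    then obtain u where u: "0 \<le> u" "u \<le> 1" "v = (1 - u) *\<^sub>R (1/2) + u *\<^sub>R w"
      by (auto simp: in_segment)
    then have v: "Re v = (1 - u) / 2 + u * Re w" "Im v = u * Im w" by auto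
    show "v \<in> S"
    proof (cases "u = 0 \<or> Im w = 0")
      case False
      then show ?thesis by (simp add: S v)
    next
      case True
      have "0 < (1 - u) / 2 + u * r \<and> (1 - u) / 2 + u * r < 1" if "u = 0 \<or> 0 < r \<and> r < 1" for r
      proof (cases "u = 0")
        case False
        then have "0 < u * r" "u * r < u" using that u by auto
        then show ?thesis using u by (simp add: field_simps)
      qed simp
      then show ?thesis using True w by (auto simp: S v)
    qed
  qed
  moreover have "1/2 \<in> S" by (simp add: S)
  ultimately have "starlike S" by (auto simp: starlike_def)
  then show "connected S" by (rule starlike_imp_connected)
qed

text \<open>The derivatives of \<open>Li2 w\<close> and \<open>Li2 (1 - w)\<close> are -Ln(1-w)/w
  and Ln(w)/(1-w), the negatives of the two terms that the product rule gives for
  \<open>Ln w * Ln (1 - w)\<close>.\<close>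

lemma Li2_reflection:
  assumes "w \<notin> complex_of_real ` {1..}" "w \<notin> complex_of_real ` {..0}"
  shows "Li2 w + Ln w * Ln (1 - w) + Li2 (1 - w) = zeta2"
proof -
  define S where "S = {w. w \<notin> complex_of_real ` {1..} \<and> w \<notin> complex_of_real ` {..0}}"
  let ?G = "\<lambda>w. Li2 w + Ln w * Ln (1 - w) + Li2 (1 - w)"
  have "(?G has_field_derivative 0) (at w)" if "w \<in> S" for w
  proof -
    have cut: "1 - w \<notin> \<real>\<^sub>\<le>\<^sub>0" "w \<notin> \<real>\<^sub>\<le>\<^sub>0" and slit: "w \<notin> complex_of_real ` {1..}"
      using that by (auto simp: S_def notin_slit_iff nonpos_Reals_eq)
    then have w: "w \<noteq> 1" "w \<noteq> 0" by auto
    have "1 - w \<notin> complex_of_real ` {1..}"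
      using cut by (simp add: notin_slit_iff)
    then have 1: "((\<lambda>w. Li2 (1 - w)) has_field_derivative Li2_integrand (1 - w) * (- 1)) (at w)"
      by (intro DERIV_chain2[OF Li2_has_field_derivative]) (auto intro!: derivative_eq_intros)
    have 2: "((\<lambda>w. Ln w * Ln (1 - w)) has_field_derivative
        Ln (1 - w) / w - Ln w / (1 - w)) (at w)"
      using cut w by (auto intro!: derivative_eq_intros simp: field_simps)
    have "(?G has_field_derivative
        Li2_integrand w + (Ln (1 - w) / w - Ln w / (1 - w)) + Li2_integrand (1 - w) * (- 1)) (at w)"
      using slit by (intro DERIV_add 1 2 Li2_has_field_derivative) auto
    then show ?thesis
      using w by (simp add: Li2_integrand_def)
  qed
  then have "?G constant_on S"
    using doubly_slit_plane[folded S_def] by (intro has_field_derivative_0_imp_constant_on)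
  then obtain k where k: "\<And>w. w \<in> S \<Longrightarrow> ?G w = k"
    by (auto simp: constant_on_def)
  have "((\<lambda>x. ?G (complex_of_real x)) \<longlongrightarrow> 0 + 0 + zeta2) (at_right 0)"
  proof (intro tendsto_add)
    have "isCont Li2 0"
      by (rule DERIV_isCont[OF Li2_has_field_derivative]) auto
    then show "((\<lambda>x. Li2 (complex_of_real x)) \<longlongrightarrow> 0) (at_right 0)"
      by (intro isCont_tendsto_compose[of 0 Li2, unfolded Li2_0])
        (auto intro!: tendsto_eq_intros)
    have "((\<lambda>x::real. ln x * ln (1 - x)) \<longlongrightarrow> 0) (at_right 0)"
      by real_asymp
    then have "((\<lambda>x. complex_of_real (ln x * ln (1 - x))) \<longlongrightarrow> complex_of_real 0) (at_right 0)"
      by (rule tendsto_of_real)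
    \<comment> \<open>For 0 < x < 1 both principal logarithms are real, which transfers the real
      limit to the complex product.\<close>
    moreover have "\<forall>\<^sub>F x in at_right 0.
        complex_of_real (ln x * ln (1 - x)) = Ln (complex_of_real x) * Ln (1 - complex_of_real x)"
      using eventually_at_right_less[of 0] eventually_at_right_real[of 0 1, simplified]
    proof eventually_elim
      case (elim x)
      then have "Ln (1 - complex_of_real x) = complex_of_real (ln (1 - x))"
        using Ln_of_real[of "1 - x"] by simp
      with elim show ?case by (simp add: Ln_of_real)
    qed
    ultimately show "((\<lambda>x. Ln (complex_of_real x) * Ln (1 - complex_of_real x)) \<longlongrightarrow> 0) (at_right 0)"
      by (simp add: tendsto_cong)
    \<comment> \<open>For 0 < x < 1 the point 1 - x lies in the open unit disc, so 1 is approached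
      as in \<open>Li2_tendsto_zeta2\<close>.\<close>
    have "filterlim (\<lambda>x. 1 - complex_of_real x) (at 1 within ball 0 1) (at_right 0)"
      unfolding filterlim_at
    proof
      show "((\<lambda>x. 1 - complex_of_real x) \<longlongrightarrow> 1) (at_right 0)"
        by (auto intro!: tendsto_eq_intros)
      show "\<forall>\<^sub>F x in at_right 0. 1 - complex_of_real x \<in> ball 0 1 \<and> 1 - complex_of_real x \<noteq> 1"
        using eventually_at_right_real[of 0 1, simplified]
      proof eventually_elim
        case (elim x)
        have "norm (1 - complex_of_real x) = \<bar>1 - x\<bar>"
          by (metis norm_of_real of_real_1 of_real_diff)
        with elim show ?case by simp
      qed
    qed
    then show "((\<lambda>x. Li2 (1 - complex_of_real x)) \<longlongrightarrow> zeta2) (at_right 0)"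
      by (rule filterlim_compose[OF Li2_tendsto_zeta2])
  qed
  moreover have "\<forall>\<^sub>F x in at_right 0. ?G (complex_of_real x) = k"
    using eventually_at_right_real[of 0 1, simplified]
    by eventually_elim (auto intro!: k simp: S_def)
  ultimately have "((\<lambda>x::real. k) \<longlongrightarrow> zeta2) (at_right 0)"
    by (simp add: tendsto_cong)
  then have "k = zeta2"
    by (simp add: tendsto_const_iff)
  then show ?thesis
    using k assms by (simp add: S_def)
qed

section \<open>Transfer of both identities to the maps of the Riemann sphere\<close>

lemma tr_succ_pred:
  assumes "j \<in> {0, 2, 4}" and "tr j p = Some w" and "w \<noteq> 1"
  shows "tr (j + 1) p = Some (1 - w)" and "tr (j - 1) p = Some (w / (w - 1))"
proof -
  have pred: "tr 5 (Some w) = Some (w / (w - 1))" and succ: "tr 1 (Some w) = Some (1 - w)"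
    using assms(3) by (simp_all add: tr_def sphere_moebius_def)
  \<comment> \<open>For even j, composing \<open>tr 1\<close> or \<open>tr 5\<close> with
    \<open>tr j\<close> raises or lowers the index by one modulo 6; for odd j it does not.\<close>
  have "tr (j + 1) p = tr 1 (tr j p)"
    using assms(1)
    by (cases p) (auto simp: tr_def sphere_moebius_def divide_simps algebra_simps)
  then show "tr (j + 1) p = Some (1 - w)"
    by (simp only: assms(2) succ)
  have "tr (j - 1) p = tr 5 (tr j p)"
    using assms(1)
    by (cases p) (auto simp: tr_def sphere_moebius_def divide_simps algebra_simps)
  then show "tr (j - 1) p = Some (w / (w - 1))"
    by (simp only: assms(2) pred)
qed

text \<open>This is \<open>tr_Dom\<close> at the point \<open>inv (tr j) \<alpha>\<close>, which is
  again 0, 1 or \<infinity> and is sent back to \<alpha> by \<open>tr j\<close>.\<close>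

lemma tr_mem_Dom:
  assumes "j \<in> {0, 2, 4}" and "\<alpha> \<in> {Some 0, Some 1}" and "p \<in> Dom (inv (tr j) \<alpha>)"
  shows "tr j p \<in> Dom \<alpha>"
proof -
  have "inv (tr j) \<alpha> \<in> {Some 0, Some 1, None}" and "tr j (inv (tr j) \<alpha>) = \<alpha>"
    using assms(1,2) by (auto simp: tr_inverse_values) (simp_all add: tr_def sphere_moebius_def)
  then show ?thesis
    using tr_Dom[of "inv (tr j) \<alpha>" p j] assms(3) by simp
qed

theorem proposition2p1:
  fixes j :: int
  assumes "j \<in> {0, 2, 4}"
  shows
    "(\<forall>z \<in> Dom (inv (tr j) (Some 0)) \<inter> Dom (inv (tr j) (Some 1)).
        Li2 (the (tr j z)) + Ln (the (tr j z)) * Ln (the (tr (j + 1) z)) + Li2 (the (tr (j + 1) z))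
          = zeta2) \<and>
     (\<forall>z \<in> Dom (inv (tr j) (Some 0)).
        Li2 (the (tr (j - 1) z)) = - Li2 (the (tr j z)) - 1/2 * (Ln (the (tr (j + 1) z)))\<^sup>2)"
proof -
  \<comment> \<open>Membership in \<open>Dom (Some 0)\<close> excludes both \<infinity> and 1 as
    values of \<open>tr j z\<close>. All three images are therefore finite, and \<open>the\<close>
    returns actual complex numbers.\<close>
  have *: "\<exists>w. tr j z = Some w \<and> w \<notin> complex_of_real ` {1..} \<and>
      tr (j + 1) z = Some (1 - w) \<and> tr (j - 1) z = Some (w / (w - 1))"
    if z: "z \<in> Dom (inv (tr j) (Some 0))" for z
  proof -
    have mem: "tr j z \<in> Dom (Some 0)"
      using tr_mem_Dom[OF assms _ z] by simp
    then obtain w where w: "tr j z = Some w"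
      by (cases "tr j z") (auto simp: in_Dom_iff)
    with mem have slit: "w \<notin> complex_of_real ` {1..}"
      by (simp add: in_Dom_iff)
    then have "w \<noteq> 1" by (auto simp: notin_slit_iff)
    with w slit tr_succ_pred[OF assms] show ?thesis by blast
  qed
  show ?thesis
  proof (intro conjI ballI)
    fix z assume z: "z \<in> Dom (inv (tr j) (Some 0)) \<inter> Dom (inv (tr j) (Some 1))"
    then obtain w where w: "tr j z = Some w" "w \<notin> complex_of_real ` {1..}"
        "tr (j + 1) z = Some (1 - w)"
      using * by blast
    moreover have "w \<notin> complex_of_real ` {..0}"
      using tr_mem_Dom[OF assms, of "Some 1" z] z w(1) by (simp add: in_Dom_iff)
    ultimately show "Li2 (the (tr j z)) + Ln (the (tr j z)) * Ln (the (tr (j + 1) z))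
        + Li2 (the (tr (j + 1) z)) = zeta2"
      by (simp add: Li2_reflection)
  next
    fix z assume "z \<in> Dom (inv (tr j) (Some 0))"
    then obtain w where "tr j z = Some w" "w \<notin> complex_of_real ` {1..}"
        "tr (j + 1) z = Some (1 - w)" "tr (j - 1) z = Some (w / (w - 1))"
      using * by blast
    then show "Li2 (the (tr (j - 1) z)) = - Li2 (the (tr j z)) - 1/2 * (Ln (the (tr (j + 1) z)))\<^sup>2"
      using Li2_landen by simp
  qed
qed

end
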